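(* Let $p$ be a probability density on $\mathbb{R}^d$, let $p_1=p$ and $p_0=\mathcal N(0,I)$, and for $t\in[0,1]$ let $p_t$ be the law of $x_t=(1-t)z+tx$, where $x\sim p_1$ and $z\sim p_0$ are independent. Let $\Phi_{t\to s}:\mathbb{R}^d\to\mathbb{R}^d$, $0\le t\le s\le 1$, be a family of (measurable) flow maps, and assume that for every $0\le t\le s\le 1$, $$(\Phi_{t\to s})_\# p_t = p_s .$$ Let $\tau\in(0,1)$. Let $x\sim p_1$, draw $z\sim p_0$ independently of $x$, set $$\hat x=(1-\tau)z+\tau x,$$ and set $x^+=\Phi_{\tau\to 1}(\hat x)$. Then $x^+\sim p_1=p$.
   Context: Here $\mathcal N(0,I)$ is the standard Gaussian distribution on $\mathbb{R}^d$. The target density $p$ is identified with the probability measure it defines, and $p_t$ denotes a probability law on $\mathbb{R}^d$. For a measurable map $\Phi$ and a probability measure $\mu$, $\Phi_\#\mu$ denotes the pushforward measure, i.e. the law of $\Phi(X)$ when $X\sim\mu$. The map $\Phi_{t\to s}$ is thought of as the exact flow map carrying a point at bridge time $t$ to bridge time $s$; the pushforward property is the only property of it that is assumed. *)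

theory Defs
  imports "HOL-Probability.Probability"
begin

definition std_gaussian :: "(real ^ 'n) measure" where
  "std_gaussian =
     density lborel (\<lambda>v. ennreal (exp (- (norm v)\<^sup>2 / 2) / sqrt (2 * pi) ^ CARD('n)))"

definition prob_density :: "(real ^ 'n \<Rightarrow> real) \<Rightarrow> bool" where
  "prob_density p \<longleftrightarrow>
     p \<in> borel_measurable borel \<and> (\<forall>v. 0 \<le> p v) \<and> (\<integral>\<^sup>+ v. ennreal (p v) \<partial>lborel) = 1"

definition density_law :: "(real ^ 'n \<Rightarrow> real) \<Rightarrow> (real ^ 'n) measure" where
  "density_law p = density lborel (\<lambda>v. ennreal (p v))"

(* Law of (1 - t) z + t x; the product measure is the joint law of the independent
   pair (z, x), with z standard Gaussian and x of density p. *)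
definition bridge_law :: "(real ^ 'n \<Rightarrow> real) \<Rightarrow> real \<Rightarrow> (real ^ 'n) measure" where
  "bridge_law p t =
     distr (std_gaussian \<Otimes>\<^sub>M density_law p) borel (\<lambda>(z, x). (1 - t) *\<^sub>R z + t *\<^sub>R x)"

end

theory Submission
  imports Defs
begin

text \<open>The interpolant of the independent pair has law \<open>bridge_law p \<tau>\<close>,
  because independence makes the joint law of \<open>z\<close> and \<open>x\<close> the product
  measure from which that law is built (\<open>distr_bridge\<close>). Applying
  \<open>\<Phi> \<tau> 1\<close> pushes this law forward, so the assumed transport property yields
  \<open>bridge_law p 1\<close>. At time 1 the interpolant is \<open>x\<close> itself, so this
  endpoint law is \<open>density_law p\<close>.\<close>

lemma (in prob_space) indep_set_commute: "indep_set A B \<longleftrightarrow> indep_set B A"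
proof -
  have "prob (a \<inter> b) = prob a * prob b \<longleftrightarrow> prob (b \<inter> a) = prob b * prob a" for a b
    by (simp only: Int_commute mult.commute)
  thus ?thesis
    unfolding indep_sets2_eq by blast
qed

text \<open>Reconciles two orders: the independence hypothesis puts \<open>x\<close> first, whereas
  \<open>bridge_law\<close> pushes forward the law of the pair with \<open>z\<close> first.\<close>

lemma (in prob_space) indep_var_commute: "indep_var S X T Y \<longleftrightarrow> indep_var T Y S X"
  unfolding indep_var_eq by (subst indep_set_commute) blast

text \<open>Realises the bridge law by random variables on \<open>M\<close>. It holds for every real
  \<open>t\<close>; the theorem takes \<open>t = \<tau>\<close> and \<open>t = 1\<close>.\<close>

lemma (in prob_space) distr_bridge:
  fixes x z :: "'a \<Rightarrow> real ^ 'n"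
  assumes x: "x \<in> borel_measurable M" "distr M borel x = density_law p"
    and z: "z \<in> borel_measurable M" "distr M borel z = std_gaussian"
    and indep: "indep_var borel x borel z"
  shows "distr M borel (\<lambda>\<omega>. (1 - t) *\<^sub>R z \<omega> + t *\<^sub>R x \<omega>) = bridge_law p t"
proof -
  have "indep_var borel z borel x"
    using indep by (rule iffD1[OF indep_var_commute])
  hence joint: "std_gaussian \<Otimes>\<^sub>M density_law p = distr M (borel \<Otimes>\<^sub>M borel) (\<lambda>\<omega>. (z \<omega>, x \<omega>))"
    using x z by (simp add: indep_var_distribution_eq)
  \<comment> \<open>With the product replaced by the joint law, the bridge law is an image of an
    image of \<open>M\<close>, hence the image under the composite map.\<close>
  have "bridge_law p t = distr M borel ((\<lambda>(z, x). (1 - t) *\<^sub>R z + t *\<^sub>R x) \<circ> (\<lambda>\<omega>. (z \<omega>, x \<omega>)))"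
    unfolding bridge_law_def joint using x(1) z(1) by (intro distr_distr) measurable
  thus ?thesis by (simp add: comp_def)
qed

theorem proposition1:
  fixes p :: "real ^ 'n \<Rightarrow> real"
    and \<Phi> :: "real \<Rightarrow> real \<Rightarrow> real ^ 'n \<Rightarrow> real ^ 'n"
    and M :: "'w measure"
    and x z :: "'w \<Rightarrow> real ^ 'n"
    and \<tau> :: real
  assumes "prob_density p"
    and "\<And>t s. 0 \<le> t \<Longrightarrow> t \<le> s \<Longrightarrow> s \<le> 1 \<Longrightarrow> \<Phi> t s \<in> borel_measurable borel"
    and "\<And>t s. 0 \<le> t \<Longrightarrow> t \<le> s \<Longrightarrow> s \<le> 1 \<Longrightarrow>
           distr (bridge_law p t) borel (\<Phi> t s) = bridge_law p s"
    and "0 < \<tau>" and "\<tau> < 1"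
    and "prob_space M"
    and "x \<in> borel_measurable M" and "distr M borel x = density_law p"
    and "z \<in> borel_measurable M" and "distr M borel z = std_gaussian"
    and "prob_space.indep_var M borel x borel z"
  shows "distr M borel (\<lambda>\<omega>. \<Phi> \<tau> 1 ((1 - \<tau>) *\<^sub>R z \<omega> + \<tau> *\<^sub>R x \<omega>)) = bridge_law p 1 \<and>
         bridge_law p 1 = density_law p"
proof -
  interpret prob_space M by fact
  note bridge = distr_bridge[OF assms(7-11)]
  have [measurable]: "x \<in> borel_measurable M" "z \<in> borel_measurable M" "\<Phi> \<tau> 1 \<in> borel_measurable borel"
    using assms by auto
  have "distr M borel (\<lambda>\<omega>. \<Phi> \<tau> 1 ((1 - \<tau>) *\<^sub>R z \<omega> + \<tau> *\<^sub>R x \<omega>))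
      = distr (bridge_law p \<tau>) borel (\<Phi> \<tau> 1)"
    \<comment> \<open>Unfolding the bridge law at \<open>\<tau>\<close> as a law on \<open>M\<close>
      turns the right side into an iterated pushforward, which collapses to the left side.\<close>
    by (simp add: bridge[symmetric] distr_distr comp_def)
  also have "\<dots> = bridge_law p 1"
    using assms(3)[of \<tau> 1] assms(4,5) by simp
  \<comment> \<open>For the second conjunct, \<open>bridge\<close> at 1 has coefficients 0 and 1, so
    it equates the law of \<open>x\<close> with \<open>bridge_law p 1\<close>.\<close>
  finally show ?thesis
    using bridge[of 1] assms(8) by simp
qed

end
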